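(* For all positive integers $k$ and $n$ and every permutation graph $Q$ of length $k$, $$\mathrm{gex}(Q,n)\le \tfrac{8}{3}(k+2)^2\,2^{4(k+1)}\,n.$$
   Context: Write $[n]=\{1,\dots,n\}$. A graph here means an ordered graph: a linearly ordered vertex set $V$ together with a set $E$ of $2$-element subsets of $V$. A graph $A=(V_1,E_1)$ contains a graph $B=(V_2,E_2)$ if there are an increasing injection $f:V_2\to V_1$ and an injection $g:E_2\to E_1$ with $f(e)\subseteq g(e)$ for every $e\in E_2$; otherwise $A$ avoids $B$. $\mathrm{gex}(Q,n)$ is the maximum number of edges in a graph with $n$ vertices that avoids $Q$. A permutation graph of length $k$ is the graph associated with a $k\times k$ permutation matrix; that is, for some permutation $\pi$ of $[k]$, it is the ordered graph with vertex set $[2k]$ and edge set $\{\{i,k+\pi(i)\}: i\in[k]\}$. *)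

theory Defs
  imports Complex_Main "HOL-Combinatorics.Permutations"
begin

text \<open>
  An ordered graph is a pair \<open>(V, E)\<close>; the linear order on the vertex set \<open>V\<close> is the one induced
  by the ambient linearly ordered type.
\<close>

type_synonym 'a ograph = "'a set \<times> 'a set set"

definition ograph :: "'a::linorder ograph \<Rightarrow> bool" where
  "ograph G \<longleftrightarrow> (case G of (V, E) \<Rightarrow> \<forall>e\<in>E. e \<subseteq> V \<and> card e = 2)"

definition contains :: "'a::linorder ograph \<Rightarrow> 'b::linorder ograph \<Rightarrow> bool" where
  "contains A B \<longleftrightarrow> (case A of (V\<^sub>1, E\<^sub>1) \<Rightarrow> case B of (V\<^sub>2, E\<^sub>2) \<Rightarrow>
     \<exists>f g. strict_mono_on V\<^sub>2 f \<and> f ` V\<^sub>2 \<subseteq> V\<^sub>1 \<and>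
           inj_on g E\<^sub>2 \<and> g ` E\<^sub>2 \<subseteq> E\<^sub>1 \<and> (\<forall>e\<in>E\<^sub>2. f ` e \<subseteq> g e))"

abbreviation avoids :: "'a::linorder ograph \<Rightarrow> 'b::linorder ograph \<Rightarrow> bool" where
  "avoids A B \<equiv> \<not> contains A B"

text \<open>
  Every finite ordered graph is isomorphic to one whose vertices are natural numbers, so it suffices
  to let \<open>V\<close> range over sets of naturals. The maximum is over a finite set, which is
  nonempty as soon as \<open>Q\<close> has an edge (see \<open>gex_attained\<close> below).
\<close>

definition gex :: "'a::linorder ograph \<Rightarrow> nat \<Rightarrow> nat" where
  "gex Q n = Max {card E | (V :: nat set) E.
     finite V \<and> card V = n \<and> ograph (V, E) \<and> avoids (V, E) Q}"

definition perm_graph :: "nat \<Rightarrow> (nat \<Rightarrow> nat) \<Rightarrow> nat ograph" where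
  "perm_graph k \<pi> = ({1..2*k}, {{i, k + \<pi> i} | i. i \<in> {1..k}})"

definition is_permutation_graph :: "nat \<Rightarrow> nat ograph \<Rightarrow> bool" where
  "is_permutation_graph k Q \<longleftrightarrow> (\<exists>\<pi>. \<pi> permutes {1..k} \<and> Q = perm_graph k \<pi>)"

lemma finite_gex_set:
  "finite {card E | (V :: nat set) E.
     finite V \<and> card V = n \<and> ograph (V, E) \<and> avoids (V, E) Q}"
proof (rule finite_subset[of _ "{..2 ^ n}"])
  show "{card E | (V :: nat set) E.
     finite V \<and> card V = n \<and> ograph (V, E) \<and> avoids (V, E) Q} \<subseteq> {..2 ^ n}"
  proof clarsimp
    fix V :: "nat set" and E
    assume V: "finite V" and E: "ograph (V, E)"
    have "E \<subseteq> Pow V" using E by (auto simp: ograph_def)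
    then have "card E \<le> card (Pow V)" using V by (intro card_mono) auto
    then show "card E \<le> 2 ^ card V" using V by (simp add: card_Pow)
  qed
qed simp

lemma card_le_gex:
  assumes "finite (V :: nat set)" "card V = n" "ograph (V, E)" "avoids (V, E) Q"
  shows "card E \<le> gex Q n"
  unfolding gex_def by (rule Max_ge[OF finite_gex_set]) (intro CollectI exI conjI, rule refl, (rule assms)+)

lemma gex_attained:
  assumes "snd Q \<noteq> {}"
  shows "\<exists>(V :: nat set) E. finite V \<and> card V = n \<and> ograph (V, E) \<and> avoids (V, E) Q \<and>
           card E = gex Q n"
proof -
  let ?S = "{card E | (V :: nat set) E.
     finite V \<and> card V = n \<and> ograph (V, E) \<and> avoids (V, E) Q}"
  obtain V\<^sub>0 :: "nat set" where V0: "finite V\<^sub>0" "card V\<^sub>0 = n"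
    by (rule that[of "{1..n}"]) simp_all
  have "ograph (V\<^sub>0, {})" "avoids (V\<^sub>0, {}) Q"
    using assms by (auto simp: ograph_def contains_def split: prod.splits)
  with V0 have "card ({} :: nat set set) \<in> ?S"
    by (intro CollectI exI conjI) (rule refl, assumption+)
  then have "?S \<noteq> {}" by (metis empty_iff)
  then have "gex Q n \<in> ?S" unfolding gex_def by (rule Max_in[OF finite_gex_set])
  then obtain V :: "nat set" and E where "gex Q n = card E" "finite V" "card V = n"
    "ograph (V, E)" "avoids (V, E) Q" by (elim CollectE exE conjE)
  then show ?thesis by (intro exI conjI) (assumption | rule sym, assumption)+
qed

lemma ograph_perm_graph:
  assumes "\<pi> permutes {1..k}"
  shows "ograph (perm_graph k \<pi>)"
proof -
  have "{i, k + \<pi> i} \<subseteq> {1..2*k} \<and> card {i, k + \<pi> i} = 2" if "i \<in> {1..k}" for i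
  proof -
    have "\<pi> i \<in> {1..k}" using that permutes_in_image[OF assms, of i] by blast
    then show ?thesis using that by (simp add: card_insert_if)
  qed
  then show ?thesis unfolding ograph_def perm_graph_def by fastforce
qed

end

theory Submission
  imports Defs
begin

text \<open>
  Prepending one cell in the bottom left corner turns a permutation of length \<open>k\<close> into one of length
  \<open>k + 1\<close>; if the upper triangular adjacency matrix of an ordered graph contains the latter, then the
  extra cell forces all rows of the former to precede all its columns, so the graph contains the
  permutation graph. It remains to bound the number of ones of a matrix without the all-ones
  \<open>(k + 1) \<times> (k + 1)\<close> interval minor, following Fox and Cibulka and Kyncl.
  Blocks of \<open>t = 2 ^ (2 * k + 2)\<close> consecutive columns are contracted, then likewise the rows. Row segments
  with fewer than \<open>2 ^ k\<close> ones contribute at most a factor \<open>2 ^ k\<close>, so that both contractions together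
  lose a factor \<open>4 ^ k = t / 4\<close>, while the heavy segments are few by a halving argument. Counting
  the heavy segments separately for each dyadic weight keeps the exponent at \<open>4 * k\<close>.
\<close>

text \<open>The witnesses \<open>r\<close> and \<open>c\<close> are the cut points of the row and column groups; they are automatically
  increasing on the relevant range, because no cell is empty.\<close>

definition grid_minor :: "nat \<Rightarrow> nat \<Rightarrow> (nat \<times> nat) set \<Rightarrow> bool" where
  "grid_minor k l A \<longleftrightarrow> (\<exists>r c. \<forall>i<k. \<forall>j<l. \<exists>x y. (x, y) \<in> A \<and>
     r i \<le> x \<and> x < r (Suc i) \<and> c j \<le> y \<and> y < c (Suc j))"

lemma grid_minorI:
  assumes "\<And>i j. i < k \<Longrightarrow> j < l \<Longrightarrow>
    \<exists>x y. (x, y) \<in> A \<and> r i \<le> x \<and> x < r (Suc i) \<and> c j \<le> y \<and> y < c (Suc j)"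
  shows "grid_minor k l A"
  unfolding grid_minor_def using assms by (intro exI[of _ r] exI[of _ c]) simp

section \<open>Monotonicity, transposition and contraction of grid minors\<close>

lemma grid_minor_mono:
  assumes "grid_minor k l A" "A \<subseteq> B"
  shows "grid_minor k l B"
proof -
  obtain r c where rc: "\<forall>i<k. \<forall>j<l.
      \<exists>x y. (x, y) \<in> A \<and> r i \<le> x \<and> x < r (Suc i) \<and> c j \<le> y \<and> y < c (Suc j)"
    using assms(1) unfolding grid_minor_def by (elim exE) (rule that)
  show ?thesis
  proof (rule grid_minorI)
    show "\<exists>x y. (x, y) \<in> B \<and> r i \<le> x \<and> x < r (Suc i) \<and> c j \<le> y \<and> y < c (Suc j)"
      if "i < k" "j < l" for i j
      using rc[rule_format, OF that] assms(2) by blast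
  qed
qed

lemma grid_minor_converse:
  assumes "grid_minor k l (A\<inverse>)"
  shows "grid_minor l k A"
proof -
  obtain r c where rc: "\<forall>i<k. \<forall>j<l.
      \<exists>x y. (x, y) \<in> A\<inverse> \<and> r i \<le> x \<and> x < r (Suc i) \<and> c j \<le> y \<and> y < c (Suc j)"
    using assms unfolding grid_minor_def by (elim exE) (rule that)
  show ?thesis
  proof (rule grid_minorI)
    show "\<exists>x y. (x, y) \<in> A \<and> c i \<le> x \<and> x < c (Suc i) \<and> r j \<le> y \<and> y < r (Suc j)"
      if "i < l" "j < k" for i j
      using rc[rule_format, OF that(2,1)] by blast
  qed
qed

text \<open>Scaling the column cuts by \<open>t\<close> turns bounds on \<open>y div t\<close> into
  bounds on \<open>y\<close>. Hence contracting blocks of columns cannot create a minor.\<close>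

lemma grid_minor_contract:
  assumes "grid_minor k l ((\<lambda>(x, y). (x, y div t)) ` A)" and "t > 0"
  shows "grid_minor k l A"
proof -
  obtain r c where rc: "\<forall>i<k. \<forall>j<l.
      \<exists>x y. (x, y) \<in> (\<lambda>(x, y). (x, y div t)) ` A \<and>
        r i \<le> x \<and> x < r (Suc i) \<and> c j \<le> y \<and> y < c (Suc j)"
    using assms(1) unfolding grid_minor_def by (elim exE) (rule that)
  have "\<exists>x y. (x, y) \<in> A \<and> r i \<le> x \<and> x < r (Suc i) \<and> c j * t \<le> y \<and> y < c (Suc j) * t"
    if ij: "i < k" "j < l" for i j
  proof -
    obtain x y where "(x, y) \<in> A" "r i \<le> x" "x < r (Suc i)" "c j \<le> y div t" "y div t < c (Suc j)"
      using rc[rule_format, OF ij] by auto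
    then show ?thesis
      using \<open>t > 0\<close> by (metis less_eq_div_iff_mult_less_eq div_less_iff_less_mult)
  qed
  then show ?thesis by (rule grid_minorI)
qed

section \<open>Minors with one column group, and adding a column group on either side\<close>

text \<open>Each row group starts at an element of \<open>R\<close>, taken in increasing order, and
  the only column group is the interval from 0 to \<open>u\<close>. The cut
  \<open>Suc (Max R)\<close> closes the last row group.\<close>

lemma grid_minor_one_column:
  assumes "finite R" "k \<le> card R" "\<And>x. x \<in> R \<Longrightarrow> \<exists>y < u. y \<in> S x"
  shows "grid_minor k 1 (Sigma R S)"
proof -
  define xs where "xs = sorted_list_of_set R"
  have xs: "length xs = card R" "sorted_wrt (<) xs" "set xs = R"
    using assms(1) by (auto simp: xs_def)
  define r where "r i = (if i < card R then xs ! i else Suc (Max R))" for i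
  define c where "c j = (if j = 0 then 0 else u)" for j :: nat
  have "\<exists>x y. (x, y) \<in> Sigma R S \<and> r i \<le> x \<and> x < r (Suc i) \<and> c j \<le> y \<and> y < c (Suc j)"
    if "i < k" "j < 1" for i j
  proof -
    have i: "i < card R" using that assms(2) by simp
    then have x: "xs ! i \<in> R" using xs by (metis nth_mem)
    have "xs ! i < r (Suc i)"
    proof (cases "Suc i < card R")
      case True
      then show ?thesis using xs by (simp add: r_def sorted_wrt_nth_less)
    next
      case False
      then show ?thesis using x assms(1) by (simp add: r_def le_imp_less_Suc)
    qed
    moreover obtain y where "y < u" "y \<in> S (xs ! i)" using assms(3) x by blast
    ultimately show ?thesis using x i that
      by (intro exI[of _ "xs ! i"] exI[of _ y]) (auto simp: r_def c_def)
  qed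
  then show ?thesis by (rule grid_minorI)
qed

text \<open>The last column cut is replaced by \<open>mid\<close>, which is harmless since
  \<open>S\<close> lies below \<open>mid\<close>, and \<open>hi\<close> closes a new group. The
  smaller minor has at least one column, so every row group contains some row of \<open>R\<close>,
  and that row supplies the entry in the new group.\<close>

lemma grid_minor_extend_right:
  assumes "grid_minor k (Suc l) (Sigma R S)"
    and S: "\<And>x. x \<in> R \<Longrightarrow> S x \<subseteq> T x \<inter> {..<mid}"
    and T: "\<And>x. x \<in> R \<Longrightarrow> \<exists>y \<in> T x. mid \<le> y \<and> y < hi"
  shows "grid_minor k (Suc (Suc l)) (Sigma R T)"
proof -
  obtain r c where rc: "\<forall>i<k. \<forall>j<Suc l.
      \<exists>x y. (x, y) \<in> Sigma R S \<and> r i \<le> x \<and> x < r (Suc i) \<and> c j \<le> y \<and> y < c (Suc j)"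
    using assms(1) unfolding grid_minor_def by (elim exE) (rule that)
  define c' where "c' j = (if j \<le> l then c j else if j = Suc l then mid else hi)" for j
  have "\<exists>x y. (x, y) \<in> Sigma R T \<and> r i \<le> x \<and> x < r (Suc i) \<and> c' j \<le> y \<and> y < c' (Suc j)"
    if ij: "i < k" "j < Suc (Suc l)" for i j
  proof (cases "j = Suc l")
    case True
    obtain x where x: "x \<in> R" "r i \<le> x" "x < r (Suc i)" using rc[rule_format, OF \<open>i < k\<close>, of 0] by auto
    then show ?thesis using T[of x] True by (auto simp: c'_def)
  next
    case False
    then obtain x y where xy: "x \<in> R" "y \<in> S x" "r i \<le> x" "x < r (Suc i)" "c j \<le> y" "y < c (Suc j)"
      using rc[rule_format, of i j] ij by auto
    then have "y \<in> T x" "y < mid" using S by auto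
    then show ?thesis using xy False that
      by (intro exI[of _ x] exI[of _ y]) (auto simp: c'_def)
  qed
  then show ?thesis by (rule grid_minorI)
qed

text \<open>Mirror image of the extension to the right: the cut \<open>c 0\<close> becomes
  \<open>mid\<close>, the later cuts shift by one index, and 0 opens the new first group.\<close>

lemma grid_minor_extend_left:
  assumes "grid_minor k (Suc l) (Sigma R S)"
    and S: "\<And>x. x \<in> R \<Longrightarrow> S x \<subseteq> T x \<inter> {mid..}"
    and T: "\<And>x. x \<in> R \<Longrightarrow> \<exists>y \<in> T x. y < mid"
  shows "grid_minor k (Suc (Suc l)) (Sigma R T)"
proof -
  obtain r c where rc: "\<forall>i<k. \<forall>j<Suc l.
      \<exists>x y. (x, y) \<in> Sigma R S \<and> r i \<le> x \<and> x < r (Suc i) \<and> c j \<le> y \<and> y < c (Suc j)"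
    using assms(1) unfolding grid_minor_def by (elim exE) (rule that)
  define c' where "c' j = (if j = 0 then 0 else if j = 1 then mid else c (j - 1))" for j
  have "\<exists>x y. (x, y) \<in> Sigma R T \<and> r i \<le> x \<and> x < r (Suc i) \<and> c' j \<le> y \<and> y < c' (Suc j)"
    if ij: "i < k" "j < Suc (Suc l)" for i j
  proof (cases j)
    case 0
    obtain x where x: "x \<in> R" "r i \<le> x" "x < r (Suc i)" using rc[rule_format, OF \<open>i < k\<close>, of 0] by auto
    then show ?thesis using T[of x] 0 by (auto simp: c'_def)
  next
    case (Suc j')
    then obtain x y where xy: "x \<in> R" "y \<in> S x" "r i \<le> x" "x < r (Suc i)" "c j' \<le> y" "y < c (Suc j')"
      using rc[rule_format, of i j'] ij by auto
    then have "y \<in> T x" "mid \<le> y" using S by auto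
    then show ?thesis using xy Suc
      by (intro exI[of _ x] exI[of _ y]) (auto simp: c'_def)
  qed
  then show ?thesis by (rule grid_minorI)
qed

section \<open>Rows with many ones inside a window of dyadic length\<close>

lemma card_nonempty_rows_le:
  assumes "finite R" "\<And>x. x \<in> R \<Longrightarrow> S x \<noteq> {} \<and> S x \<subseteq> {..<u}"
    and "\<not> grid_minor (Suc q) 1 (Sigma R S)"
  shows "card R \<le> q"
proof (rule ccontr)
  assume "\<not> card R \<le> q"
  moreover have "\<exists>y < u. y \<in> S x" if "x \<in> R" for x
    using assms(2)[OF that] by blast
  ultimately show False
    using grid_minor_one_column[OF assms(1), of "Suc q" u S] assms(3) by simp
qed

text \<open>
  Halve the window. Rows confined to one half are handled with the same \<open>m\<close>; any other row keeps
  half of its ones in one half, and its nonempty other half supplies an extra column group, so there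
  \<open>m\<close> drops by one. The resulting recurrence is Pascal's rule.
\<close>

lemma card_heavy_rows_le:
  assumes "finite R" "\<And>x. x \<in> R \<Longrightarrow> S x \<subseteq> {lo..<lo + 2 ^ (a + d)}"
    and "\<And>x. x \<in> R \<Longrightarrow> 2 ^ a \<le> card (S x)"
    and "\<not> grid_minor (Suc q) (Suc m) (Sigma R S)" and "m \<le> a"
  shows "card R \<le> q * (2 ^ (d + m) * ((d + m) choose m))"
  using assms
proof (induction "a + d" arbitrary: a d m lo R S)
  case 0
  have "card R \<le> q"
  proof (rule card_nonempty_rows_le[OF "0.prems"(1)])
    show "S x \<noteq> {} \<and> S x \<subseteq> {..<lo + 1}" if "x \<in> R" for x
      using "0.prems"(2,3)[OF that] "0.hyps" by auto
  qed (use "0.prems"(4,5) "0.hyps" in simp)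
  with 0 show ?case by simp
next
  case (Suc b)
  note R = Suc.prems
  show ?case
  proof (cases m)
    case 0
    have "card R \<le> q"
    proof (rule card_nonempty_rows_le[OF R(1)])
      show "S x \<noteq> {} \<and> S x \<subseteq> {..<lo + 2 ^ (a + d)}" if "x \<in> R" for x
        using R(2,3)[OF that] by auto
    qed (use R(4) 0 in simp)
    also have "\<dots> \<le> q * 2 ^ d" by simp
    finally show ?thesis using 0 by simp
  next
    case (Suc m')
    then obtain a' where a: "a = Suc a'" using R(5) by (cases a) auto
    have b: "b = a' + d" using Suc.hyps(2) a by simp
    have pow: "(2::nat) ^ (a + d) = 2 ^ b + 2 ^ b" unfolding Suc.hyps(2)[symmetric] by simp
    define mid where "mid = lo + 2 ^ b"
    define L where "L x = S x \<inter> {..<mid}" for x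
    define U where "U x = S x \<inter> {mid..}" for x
    have LU: "S x = L x \<union> U x" for x by (auto simp: L_def U_def)
    have Lsub: "L x \<subseteq> {lo..<lo + 2 ^ b}" and Usub: "U x \<subseteq> {mid..<mid + 2 ^ b}" if "x \<in> R" for x
      using R(2)[OF that] by (auto simp: L_def U_def mid_def pow)
    have fin: "finite (L x)" "finite (U x)" if "x \<in> R" for x
      using Lsub[OF that] Usub[OF that] by (auto intro: finite_subset)
    \<comment> \<open>\<open>R1\<close> and \<open>R2\<close> keep all \<open>2 ^ a\<close> ones in
      a window of half the length, so \<open>a\<close> stays and \<open>d\<close> drops.
      \<open>R3\<close> and \<open>R4\<close> are only guaranteed \<open>2 ^ a'\<close> ones in the
      half window, so \<open>a\<close> drops and \<open>d\<close> stays, while the other half is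
      nonempty and pays for lowering \<open>m\<close>. The classes may overlap; only their union
      matters.\<close>
    define R1 where "R1 = {x \<in> R. U x = {}}"
    define R2 where "R2 = {x \<in> R. L x = {}}"
    define R3 where "R3 = {x \<in> R. U x \<noteq> {} \<and> 2 ^ a' \<le> card (L x)}"
    define R4 where "R4 = {x \<in> R. L x \<noteq> {} \<and> 2 ^ a' \<le> card (U x)}"
    note Rdefs = R1_def R2_def R3_def R4_def
    have cover: "R \<subseteq> R1 \<union> R2 \<union> (R3 \<union> R4)"
    proof
      fix x assume x: "x \<in> R"
      have "2 ^ a \<le> card (L x) + card (U x)"
        using R(3)[OF x] LU[of x] card_Un_le[of "L x" "U x"] by simp
      then have "2 ^ a' \<le> card (L x) \<or> 2 ^ a' \<le> card (U x)" using a by auto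
      then show "x \<in> R1 \<union> R2 \<union> (R3 \<union> R4)" using x by (auto simp: Rdefs)
    qed
    have finR: "finite R1" "finite R2" "finite R3" "finite R4" using R(1) by (auto simp: Rdefs)
    have "card R \<le> card (R1 \<union> R2 \<union> (R3 \<union> R4))" using cover finR by (intro card_mono) auto
    also have "\<dots> \<le> card R1 + card R2 + (card R3 + card R4)"
      by (intro card_Un_le[THEN order_trans] add_mono card_Un_le)
    finally have split: "card R \<le> card R1 + card R2 + (card R3 + card R4)" .
    have no_minor: "\<not> grid_minor (Suc q) (Suc (Suc m')) (Sigma R' S)" if "R' \<subseteq> R" for R'
    proof -
      have "Sigma R' S \<subseteq> Sigma R S" using that by auto
      then show ?thesis using R(4) grid_minor_mono unfolding Suc by blast
    qed
    let ?B = "\<lambda>d m. q * (2 ^ (d + m) * ((d + m) choose m))"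
    have B34: "card R3 \<le> ?B d m'" "card R4 \<le> ?B d m'"
    proof -
      have no_R3: "\<not> grid_minor (Suc q) (Suc m') (Sigma R3 L)"
      proof
        assume "grid_minor (Suc q) (Suc m') (Sigma R3 L)"
        then have "grid_minor (Suc q) (Suc (Suc m')) (Sigma R3 S)"
        proof (rule grid_minor_extend_right[where mid = mid and hi = "mid + 2 ^ b"])
          show "\<exists>y\<in>S x. mid \<le> y \<and> y < mid + 2 ^ b" if "x \<in> R3" for x
            using that Usub[of x] by (fastforce simp: R3_def U_def)
        qed (auto simp: L_def)
        then show False using no_minor[of R3] by (auto simp: R3_def)
      qed
      show "card R3 \<le> ?B d m'"
      proof (rule Suc.hyps(1)[OF b finR(3)])
        show "L x \<subseteq> {lo..<lo + 2 ^ (a' + d)}" if "x \<in> R3" for x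
          using Lsub[of x] that unfolding b by (simp add: R3_def)
        show "2 ^ a' \<le> card (L x)" if "x \<in> R3" for x
          using that by (simp add: R3_def)
        show "m' \<le> a'" using R(5) a Suc by simp
      qed (rule no_R3)
      have no_R4: "\<not> grid_minor (Suc q) (Suc m') (Sigma R4 U)"
      proof
        assume "grid_minor (Suc q) (Suc m') (Sigma R4 U)"
        then have "grid_minor (Suc q) (Suc (Suc m')) (Sigma R4 S)"
        proof (rule grid_minor_extend_left[where mid = mid])
          show "\<exists>y\<in>S x. y < mid" if "x \<in> R4" for x
            using that by (auto simp: R4_def L_def)
        qed (auto simp: U_def)
        then show False using no_minor[of R4] by (auto simp: R4_def)
      qed
      show "card R4 \<le> ?B d m'"
      proof (rule Suc.hyps(1)[OF b finR(4)])
        show "U x \<subseteq> {mid..<mid + 2 ^ (a' + d)}" if "x \<in> R4" for x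
          using Usub[of x] that unfolding b by (simp add: R4_def)
        show "2 ^ a' \<le> card (U x)" if "x \<in> R4" for x
          using that by (simp add: R4_def)
        show "m' \<le> a'" using R(5) a Suc by simp
      qed (rule no_R4)
    qed
    show ?thesis
    proof (cases d)
      case 0
      \<comment> \<open>For \<open>d = 0\<close> every row fills its window, so no half is empty and
        only \<open>R3\<close> and \<open>R4\<close> remain.\<close>
      have small: "card (L x) < card (S x)" "card (U x) < card (S x)" if "x \<in> R" for x
      proof -
        have "card (L x) \<le> 2 ^ a'" "card (U x) \<le> 2 ^ a'"
          using card_mono[OF _ Lsub[OF that]] card_mono[OF _ Usub[OF that]] b 0 by auto
        moreover have "(2::nat) ^ a' < 2 ^ a" using a by simp
        ultimately show "card (L x) < card (S x)" "card (U x) < card (S x)"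
          using R(3)[OF that] by linarith+
      qed
      have "R1 = {}" "R2 = {}"
        using small LU by (force simp: R1_def, force simp: R2_def)
      then show ?thesis using split B34 Suc 0 by simp
    next
      case (Suc d')
      have b': "b = a + d'" using Suc.hyps(2) Suc by simp
      have "card R1 \<le> ?B d' m"
      proof (rule Suc.hyps(1)[OF b' finR(1)])
        show "S x \<subseteq> {lo..<lo + 2 ^ (a + d')}" if "x \<in> R1" for x
          using Lsub[of x] LU[of x] that b' by (auto simp: R1_def)
      qed (use R no_minor[of R1] \<open>m = Suc m'\<close> in \<open>auto simp: R1_def\<close>)
      moreover have "card R2 \<le> ?B d' m"
      proof (rule Suc.hyps(1)[OF b' finR(2)])
        show "S x \<subseteq> {mid..<mid + 2 ^ (a + d')}" if "x \<in> R2" for x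
          using Usub[of x] LU[of x] that b' by (auto simp: R2_def)
      qed (use R no_minor[of R2] \<open>m = Suc m'\<close> in \<open>auto simp: R2_def\<close>)
      ultimately have "card R \<le> 2 * ?B d' m + 2 * ?B d m'" using split B34 by linarith
      \<comment> \<open>Both terms have exponent and upper binomial index \<open>d + m - 1\<close>;
        the common factor 2 restores \<open>2 ^ (d + m)\<close>.\<close>
      also have "\<dots> = ?B d m" using Suc \<open>m = Suc m'\<close> by (simp add: algebra_simps)
      finally show ?thesis .
    qed
  qed
qed

text \<open>A row with between \<open>2 ^ a\<close> and \<open>2 ^ (a + 1)\<close> ones is charged
  \<open>2 ^ (a + 1)\<close>, and the number of rows with at least \<open>2 ^ a\<close> ones is
  bounded by the preceding lemma with \<open>d = b - a\<close>.\<close>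

lemma sum_heavy_rows_le:
  assumes "finite R" "\<And>x. x \<in> R \<Longrightarrow> S x \<subseteq> {lo..<lo + 2 ^ b}"
    and "\<And>x. x \<in> R \<Longrightarrow> 2 ^ m \<le> card (S x)"
    and "\<not> grid_minor (Suc q) (Suc m) (Sigma R S)" and "m \<le> b"
  shows "(\<Sum>x\<in>R. card (S x)) \<le> q * (2 ^ (b + m + 1) * (Suc b choose Suc m))"
proof -
  define H where "H a = {x \<in> R. 2 ^ a \<le> card (S x)}" for a
  \<comment> \<open>The sets \<open>H a\<close> are nested rather than disjoint; the single term
    \<open>d = b - a\<close> already dominates the weight of the row.\<close>
  have le: "card (S x) \<le> (\<Sum>d\<le>b - m. if x \<in> H (b - d) then 2 ^ (b - d + 1) else 0)" (is "_ \<le> ?s")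
    if x: "x \<in> R" for x
  proof -
    have "card (S x) \<le> 2 ^ b" using card_mono[OF _ assms(2)[OF x]] by simp
    have pos: "card (S x) > 0" using assms(3)[OF x] by (metis gr0I less_numeral_extra(3) not_le zero_less_numeral zero_less_power)
    obtain a where a: "2 ^ a \<le> card (S x)" "card (S x) < 2 ^ (a + 1)"
      using ex_power_ivl1[of 2 "card (S x)"] pos by auto
    have "m < a + 1"
      by (rule power_less_imp_less_exp[of "2 :: nat", OF _ le_less_trans[OF assms(3)[OF x] a(2)]]) simp
    then have mb: "m \<le> a" "a \<le> b"
      using power_le_imp_le_exp[of "2 :: nat", OF _ order_trans[OF a(1) \<open>card (S x) \<le> 2 ^ b\<close>]] by auto
    have "card (S x) \<le> (if x \<in> H (b - (b - a)) then 2 ^ (b - (b - a) + 1) else 0)"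
      using a mb x by (auto simp: H_def)
    also have "\<dots> \<le> ?s" using mb by (intro member_le_sum) auto
    finally show ?thesis .
  qed
  have card_H: "card (H (b - d)) \<le> q * (2 ^ (d + m) * ((d + m) choose m))" if "d \<le> b - m" for d
  proof (rule card_heavy_rows_le)
    show "S x \<subseteq> {lo..<lo + 2 ^ (b - d + d)}" if "x \<in> H (b - d)" for x
      using assms(2)[of x] that \<open>d \<le> b - m\<close> by (auto simp: H_def)
    show "\<not> grid_minor (Suc q) (Suc m) (Sigma (H (b - d)) S)"
      using assms(4) grid_minor_mono[of "Suc q" "Suc m" "Sigma (H (b - d)) S" "Sigma R S"] by (auto simp: H_def)
  qed (use assms that in \<open>auto simp: H_def\<close>)
  have "(\<Sum>x\<in>R. card (S x)) \<le> (\<Sum>x\<in>R. \<Sum>d\<le>b - m. if x \<in> H (b - d) then 2 ^ (b - d + 1) else 0)"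
    by (intro sum_mono le)
  also have "\<dots> = (\<Sum>d\<le>b - m. \<Sum>x\<in>R. if x \<in> H (b - d) then 2 ^ (b - d + 1) else 0)"
    by (rule sum.swap)
  also have "\<dots> = (\<Sum>d\<le>b - m. card (H (b - d)) * 2 ^ (b - d + 1))"
  proof (intro sum.cong refl)
    fix d
    have "R \<inter> H (b - d) = H (b - d)" by (auto simp: H_def)
    then show "(\<Sum>x\<in>R. if x \<in> H (b - d) then 2 ^ (b - d + 1) else 0) = card (H (b - d)) * 2 ^ (b - d + 1)"
      using assms(1) by (simp add: sum.inter_restrict[symmetric])
  qed
  also have "\<dots> \<le> (\<Sum>d\<le>b - m. q * 2 ^ (b + m + 1) * ((m + d) choose m))"
  proof (intro sum_mono)
    fix d assume "d \<in> {..b - m}"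
    then have d: "d \<le> b - m" by simp
    \<comment> \<open>The weight and the bound on the number of rows vary inversely, so the power of
      2 is the same for every \<open>d\<close> and only binomials are summed.\<close>
    have "(2::nat) ^ (d + m) * 2 ^ (b - d + 1) = 2 ^ (b + m + 1)"
      using d by (simp flip: power_add del: power_Suc)
    moreover have "card (H (b - d)) * 2 ^ (b - d + 1) \<le> q * (2 ^ (d + m) * ((d + m) choose m)) * 2 ^ (b - d + 1)"
      by (intro mult_right_mono card_H d) simp
    ultimately show "card (H (b - d)) * 2 ^ (b - d + 1) \<le> q * 2 ^ (b + m + 1) * ((m + d) choose m)"
      by (simp add: mult_ac add_ac)
  qed
  also have "\<dots> = q * 2 ^ (b + m + 1) * (\<Sum>d\<le>b - m. (m + d) choose m)"
    by (simp add: sum_distrib_left)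
  \<comment> \<open>This is the hockey-stick identity.\<close>
  also have "(\<Sum>d\<le>b - m. (m + d) choose m) = (Suc b choose Suc m)"
    using choose_rising_sum(1)[of m "b - m"] assms(5) by simp
  finally show ?thesis by (simp add: mult.assoc)
qed

section \<open>Contraction of a matrix and the resulting recursion\<close>

text \<open>The fibres of the contraction are row segments of length \<open>2 ^ b\<close>. Light
  segments cost at most \<open>2 ^ m\<close> per contracted entry; heavy ones are summed within each
  of the \<open>r\<close> vertical strips. The strip bound is independent of the number of
  rows.\<close>

lemma card_le_contract:
  assumes "finite A" "snd ` A \<subseteq> {..<r * 2 ^ b}"
    and minor: "\<not> grid_minor (Suc q) (Suc m) A" and "m \<le> b"
  shows "card A \<le> 2 ^ m * card ((\<lambda>(x, y). (x, y div 2 ^ b)) ` A)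
    + r * (q * (2 ^ (b + m + 1) * (Suc b choose Suc m)))"
proof -
  define t :: nat where "t = 2 ^ b"
  define f where "f = (\<lambda>(x, y). (x :: nat, y div t))"
  define S where "S j x = {y. (x, y) \<in> A \<and> y div t = j}" for j x
  define X where "X = fst ` A"
  have "t > 0" by (simp add: t_def)
  have fibre: "card {w \<in> A. f w = z} = card (S (snd z) (fst z))" for z
  proof -
    have "{w \<in> A. f w = z} = Pair (fst z) ` S (snd z) (fst z)"
      by (auto simp: f_def S_def)
    then show ?thesis by (simp add: card_image inj_on_def)
  qed
  have sub: "f ` A \<subseteq> X \<times> {..<r}"
  proof
    fix z assume "z \<in> f ` A"
    then obtain x y where "(x, y) \<in> A" "z = (x, y div t)" by (auto simp: f_def)
    moreover have "y < r * t" using assms(2) \<open>(x, y) \<in> A\<close> by (force simp: t_def)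
    ultimately show "z \<in> X \<times> {..<r}"
      using \<open>t > 0\<close> by (force simp: X_def div_less_iff_less_mult)
  qed
  \<comment> \<open>Setting light segments to 0 makes \<open>2 ^ m + h\<close> dominate every fibre
    and lets \<open>h\<close> be summed over a full rectangle strip by strip.\<close>
  define h where "h j x = (if 2 ^ m \<le> card (S j x) then card (S j x) else 0)" for j x
  have strip: "(\<Sum>x\<in>X. h j x) \<le> q * (2 ^ (b + m + 1) * (Suc b choose Suc m))" for j
  proof -
    define R where "R = {x \<in> X. 2 ^ m \<le> card (S j x)}"
    have "finite X" using assms(1) by (simp add: X_def)
    then have "(\<Sum>x\<in>X. h j x) = (\<Sum>x\<in>R. card (S j x))"
      by (simp add: h_def R_def sum.inter_filter)
    also have "\<dots> \<le> q * (2 ^ (b + m + 1) * (Suc b choose Suc m))"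
    proof (rule sum_heavy_rows_le)
      show "S j x \<subseteq> {j * t..<j * t + 2 ^ b}" for x
      proof
        fix y assume "y \<in> S j x"
        then have "y = j * t + y mod t" by (auto simp: S_def)
        moreover have "y mod t < t" using \<open>t > 0\<close> by simp
        ultimately show "y \<in> {j * t..<j * t + 2 ^ b}" unfolding t_def[symmetric]
          by (metis atLeastLessThan_iff le_add1 nat_add_left_cancel_less)
      qed
      have "Sigma R (S j) \<subseteq> A" by (auto simp: S_def)
      then show "\<not> grid_minor (Suc q) (Suc m) (Sigma R (S j))"
        using minor grid_minor_mono by blast
    qed (use \<open>finite X\<close> \<open>m \<le> b\<close> in \<open>auto simp: R_def\<close>)
    finally show ?thesis .
  qed
  have "card A = (\<Sum>z\<in>f ` A. card {w \<in> A. f w = z})"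
    using sum.image_gen[OF assms(1), of "\<lambda>_. 1 :: nat" f] by simp
  also have "\<dots> \<le> (\<Sum>z\<in>f ` A. 2 ^ m + h (snd z) (fst z))"
    by (intro sum_mono) (auto simp: fibre h_def)
  also have "\<dots> = 2 ^ m * card (f ` A) + (\<Sum>z\<in>f ` A. h (snd z) (fst z))"
    by (simp add: sum.distrib)
  also have "(\<Sum>z\<in>f ` A. h (snd z) (fst z)) \<le> (\<Sum>z\<in>X \<times> {..<r}. h (snd z) (fst z))"
    using sub assms(1) by (intro sum_mono2) (auto simp: X_def)
  also have "\<dots> = (\<Sum>j<r. \<Sum>x\<in>X. h j x)"
    by (subst sum.swap) (simp add: sum.cartesian_product case_prod_beta)
  also have "\<dots> \<le> (\<Sum>j<r. q * (2 ^ (b + m + 1) * (Suc b choose Suc m)))"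
    by (intro sum_mono strip)
  finally show ?thesis by (simp add: f_def t_def)
qed

text \<open>Contract columns, transpose, contract columns again. \<open>B\<close> is left
  transposed, since the square and the forbidden minor are symmetric. The error of the second
  contraction is multiplied by the \<open>2 ^ m\<close> of the first, hence the factor
  \<open>2 ^ m + 1\<close>.\<close>

lemma card_le_contract_both:
  assumes "A \<subseteq> {..<r * 2 ^ b} \<times> {..<r * 2 ^ b}"
    and minor: "\<not> grid_minor (Suc m) (Suc m) A" and "m \<le> b"
  obtains B where "B \<subseteq> {..<r} \<times> {..<r}" "\<not> grid_minor (Suc m) (Suc m) B"
    "card A \<le> 2 ^ m * (2 ^ m * card B) + (2 ^ m + 1) * (r * (m * (2 ^ (b + m + 1) * (Suc b choose Suc m))))"
proof -
  define f where "f = (\<lambda>(x :: nat, y). (x, y div 2 ^ b :: nat))"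
  define H where "H = r * (m * (2 ^ (b + m + 1) * (Suc b choose Suc m)))"
  define A' where "A' = (f ` A)\<inverse>"
  define B where "B = f ` A'"
  have "finite A" using assms(1) by (rule finite_subset) simp
  then have "finite A'" by (simp add: A'_def)
  have minor': "\<not> grid_minor (Suc m) (Suc m) A'"
    using minor grid_minor_converse[of "Suc m" "Suc m" "f ` A"] grid_minor_contract[of "Suc m" "Suc m" "2 ^ b" A]
    by (auto simp: A'_def f_def)
  then have "\<not> grid_minor (Suc m) (Suc m) B"
    using grid_minor_contract[of "Suc m" "Suc m" "2 ^ b" A'] by (auto simp: B_def f_def)
  moreover have "B \<subseteq> {..<r} \<times> {..<r}"
    using assms(1) by (auto simp: B_def A'_def f_def div_less_iff_less_mult)
  moreover have "card A \<le> 2 ^ m * (2 ^ m * card B) + (2 ^ m + 1) * H"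
  proof -
    have "snd ` A \<subseteq> {..<r * 2 ^ b}" "snd ` A' \<subseteq> {..<r * 2 ^ b}"
      using assms(1) by (auto simp: A'_def f_def)
    note contract = card_le_contract[OF \<open>finite A\<close> this(1) minor \<open>m \<le> b\<close>]
      card_le_contract[OF \<open>finite A'\<close> this(2) minor' \<open>m \<le> b\<close>]
    have "card A \<le> 2 ^ m * card (f ` A) + H"
      using contract(1) by (simp only: H_def f_def)
    also have "card (f ` A) = card A'" by (simp add: A'_def)
    also have "card A' \<le> 2 ^ m * card B + H"
      using contract(2) by (simp only: H_def f_def B_def)
    finally show ?thesis by (simp add: algebra_simps)
  qed
  ultimately show ?thesis using that unfolding H_def by blast
qed

text \<open>With \<open>C = m * 2 ^ (4 * m + 7)\<close>, the recursive term and the error are each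
  at most \<open>4 ^ m * r * C\<close>. Since \<open>4 ^ m = t / 4\<close> and
  \<open>r * t \<le> 2 * n\<close>, together they give at most \<open>C * n\<close>.\<close>

theorem card_le_of_not_grid_minor:
  assumes "A \<subseteq> {..<n} \<times> {..<n}" "\<not> grid_minor (Suc m) (Suc m) A" "m > 0"
  shows "card A \<le> m * 2 ^ (4 * m + 7) * n"
  using assms(1,2)
proof (induction n arbitrary: A rule: less_induct)
  case (less n)
  define C where "C = m * 2 ^ (4 * m + 7)"
  define t :: nat where "t = 2 ^ (2 * m + 2)"
  have "t \<ge> 2" by (simp add: t_def)
  show ?case
  proof (cases "n < t")
    case True
    have "card A \<le> n * n" using card_mono[OF _ less.prems(1)] by (simp add: card_cartesian_product)
    also have "\<dots> \<le> t * n" using True by simp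
    also have "t \<le> 1 * 2 ^ (4 * m + 7)" unfolding t_def mult_1 by (intro power_increasing) auto
    also have "\<dots> \<le> C" unfolding C_def using \<open>m > 0\<close> by (intro mult_right_mono) auto
    finally show ?thesis by (simp add: C_def)
  next
    case False
    define r where "r = n div t + 1"
    have "r * t = n div t * t + t" by (simp add: r_def)
    then have rt: "r * t \<le> 2 * n" using False div_times_less_eq_dividend[of n t] by linarith
    have nrt: "n < r * t" using \<open>t \<ge> 2\<close> dividend_less_div_times[of t n] by (simp add: r_def)
    have "r < n"
    proof -
      have "t \<ge> 2 ^ 3" unfolding t_def using \<open>m > 0\<close> by (intro power_increasing) auto
      then have "r * 8 \<le> r * t" by simp
      then show ?thesis using rt False \<open>t \<ge> 2\<close> by linarith
    qed
    obtain B where B: "B \<subseteq> {..<r} \<times> {..<r}" "\<not> grid_minor (Suc m) (Suc m) B"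
      and AB: "card A \<le> 2 ^ m * (2 ^ m * card B) + (2 ^ m + 1) * (r * (m *
        (2 ^ (2 * m + 2 + m + 1) * (Suc (2 * m + 2) choose Suc m))))"
    proof (rule card_le_contract_both[of A r "2 * m + 2" m])
      show "A \<subseteq> {..<r * 2 ^ (2 * m + 2)} \<times> {..<r * 2 ^ (2 * m + 2)}"
        using less.prems(1) nrt unfolding t_def[symmetric] by force
    qed (use less.prems in auto)
    \<comment> \<open>Here \<open>C\<close> is calibrated: after the crude binomial bound the powers
      of 2 add up to \<open>6 * m + 7\<close>, which is \<open>2 * m\<close> plus the exponent in
      \<open>C\<close>.\<close>
    have "(2 ^ m + 1) * (r * (m * (2 ^ (2 * m + 2 + m + 1) * (Suc (2 * m + 2) choose Suc m))))
      \<le> 2 ^ (m + 1) * (r * (m * (2 ^ (2 * m + 2 + m + 1) * 2 ^ Suc (2 * m + 2))))"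
      by (intro mult_mono order_refl binomial_le_pow2) auto
    also have "\<dots> = 2 ^ (2 * m) * (r * C)"
    proof -
      have "2 ^ (m + 1) * (r * (m * (2 ^ (2 * m + 2 + m + 1) * 2 ^ Suc (2 * m + 2))))
        = r * m * (2 ^ ((m + 1) + ((2 * m + 2 + m + 1) + Suc (2 * m + 2))))"
        by (simp only: power_add mult_ac)
      also have "(m + 1) + ((2 * m + 2 + m + 1) + Suc (2 * m + 2)) = 2 * m + (4 * m + 7)" by simp
      finally show ?thesis by (simp only: power_add C_def mult_ac)
    qed
    finally have "card A \<le> 2 ^ m * (2 ^ m * card B) + 2 ^ (2 * m) * (r * C)" using AB by linarith
    also have "card B \<le> C * r" using less.IH[OF \<open>r < n\<close> B] by (simp add: C_def)
    also have "2 ^ m * (2 ^ m * (C * r)) = 2 ^ (2 * m) * (r * C)"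
      unfolding mult_2 power_add by (simp only: mult_ac)
    finally have "2 * card A \<le> r * t * C" by (simp add: t_def power_add mult_ac)
    also have "\<dots> \<le> 2 * n * C" by (intro mult_right_mono rt) simp
    finally show ?thesis by (simp add: C_def mult_ac)
  qed
qed

section \<open>From matrices back to ordered graphs\<close>

text \<open>Row groups \<open>0\<close> to \<open>k - 1\<close> and column groups \<open>1\<close>
  to \<open>k\<close> carry the permutation. The cell \<open>(k, 0)\<close> is reserved for
  separating left from right vertices: its entry has a row index smaller than its column
  index.\<close>

lemma contains_perm_graph_of_grid_minor:
  fixes V :: "nat set" and w :: "nat \<Rightarrow> nat"
  assumes w: "strict_mono_on {..<n} w" "w ` {..<n} \<subseteq> V"
    and A: "A = {(i, j). i < j \<and> j < n \<and> {w i, w j} \<in> E}"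
    and minor: "grid_minor (Suc k) (Suc k) A" and \<pi>: "\<pi> permutes {1..k}"
  shows "contains (V, E) (perm_graph k \<pi>)"
proof -
  obtain r c where rc: "\<forall>i<Suc k. \<forall>j<Suc k.
      \<exists>x y. (x, y) \<in> A \<and> r i \<le> x \<and> x < r (Suc i) \<and> c j \<le> y \<and> y < c (Suc j)"
    using minor unfolding grid_minor_def by (elim exE) (rule that)
  \<comment> \<open>Choosing a whole pair at once makes \<open>X i j\<close> and
    \<open>Y i j\<close> coordinates of the same entry.\<close>
  define P where "P i j z \<longleftrightarrow> z \<in> A \<and> r i \<le> fst z \<and> fst z < r (Suc i) \<and> c j \<le> snd z \<and> snd z < c (Suc j)"
    for i j z
  define X where "X i j = fst (SOME z. P i j z)" for i j
  define Y where "Y i j = snd (SOME z. P i j z)" for i j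
  have XY: "(X i j, Y i j) \<in> A \<and>
      r i \<le> X i j \<and> X i j < r (Suc i) \<and> c j \<le> Y i j \<and> Y i j < c (Suc j)"
    if "i \<le> k" "j \<le> k" for i j
  proof -
    have "\<exists>z. P i j z" using rc[rule_format, of i j] that by (auto simp: P_def)
    then have "P i j (SOME z. P i j z)" by (rule someI_ex)
    then show ?thesis by (simp add: P_def X_def Y_def)
  qed
  have r_mono: "r i \<le> r i'" if "i \<le> i'" "i' \<le> Suc k" for i i'
    using that by (induction i' rule: dec_induct) (use XY[of _ 0] in \<open>force intro: order_trans\<close>)+
  have c_mono: "c j \<le> c j'" if "j \<le> j'" "j' \<le> Suc k" for j j'
    using that by (induction j' rule: dec_induct) (use XY[of 0] in \<open>force intro: order_trans\<close>)+
  \<comment> \<open>Vertex \<open>i\<close> uses row group \<open>i - 1\<close> and vertex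
    \<open>k + j\<close> uses column group \<open>j\<close>. The inverse makes both ends of an edge
    refer to the same cell, so that they form an entry of \<open>A\<close>.\<close>
  define v where "v i = (if i \<le> k then X (i - 1) (\<pi> i) else Y (inv \<pi> (i - k) - 1) (i - k))" for i
  have pi_in: "\<pi> i \<in> {1..k}" "inv \<pi> i \<in> {1..k}" if "i \<in> {1..k}" for i
    using that permutes_in_image[OF \<pi>] permutes_in_image[OF permutes_inv[OF \<pi>]] by blast+
  have edge: "(v i, v (k + \<pi> i)) \<in> A" if "i \<in> {1..k}" for i
    using XY[of "i - 1" "\<pi> i"] that pi_in(1)[OF that]
    by (auto simp: v_def permutes_inverses[OF \<pi>])
  have low: "r (i - 1) \<le> v i \<and> v i < r i" if "i \<in> {1..k}" for i
    using XY[of "i - 1" "\<pi> i"] that pi_in(1)[OF that] by (auto simp: v_def)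
  have high: "c (i - k) \<le> v i \<and> v i < c (Suc (i - k))" if "i \<in> {k + 1..2 * k}" for i
  proof -
    have i: "i - k \<in> {1..k}" using that by auto
    then show ?thesis
      using XY[of "inv \<pi> (i - k) - 1" "i - k"] pi_in(2)[OF i] that by (auto simp: v_def)
  qed
  have "v i < v j" if ij: "i \<in> {1..2 * k}" "j \<in> {1..2 * k}" "i < j" for i j
  proof -
    consider "j \<le> k" | "i \<le> k" "k < j" | "k < i" by linarith
    then show ?thesis
    proof cases
      case 1
      then have "r i \<le> r (j - 1)" using ij by (intro r_mono) auto
      then show ?thesis using 1 low[of i] low[of j] ij by auto
    next
      case 2
      \<comment> \<open>The extra cell in the last row group and the first column group separates the two halves.\<close>
      have "r k \<le> X k 0" "X k 0 < Y k 0" "Y k 0 < c 1" using XY[of k 0] A by auto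
      moreover have "r i \<le> r k" using 2 by (intro r_mono) auto
      moreover have "c 1 \<le> c (j - k)" using 2 ij by (intro c_mono) auto
      ultimately show ?thesis using 2 low[of i] high[of j] ij by auto
    next
      case 3
      then have "c (Suc (i - k)) \<le> c (j - k)" using ij by (intro c_mono) auto
      then show ?thesis using 3 high[of i] high[of j] ij by auto
    qed
  qed
  then have v: "strict_mono_on {1..2 * k} v" by (auto intro: strict_mono_onI)
  have v_less: "v i < n" if "i \<in> {1..2 * k}" for i
  proof (cases "i \<le> k")
    case True
    then show ?thesis using edge[of i] that A by auto
  next
    case False
    then have "i - k \<in> {1..k}" using that by auto
    from edge[OF pi_in(2)[OF this]] have "(v (inv \<pi> (i - k)), v i) \<in> A"
      using False by (simp add: permutes_inverses[OF \<pi>])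
    then show ?thesis using A by auto
  qed
  define f where "f = w \<circ> v"
  have f: "strict_mono_on {1..2 * k} f"
    using v w(1) v_less unfolding f_def strict_mono_on_def by auto
  have fV: "f ` {1..2 * k} \<subseteq> V" using v_less w(2) by (auto simp: f_def)
  let ?E = "{{i, k + \<pi> i} | i. i \<in> {1..k}}"
  have sub: "e \<subseteq> {1..2 * k}" if "e \<in> ?E" for e
    using that pi_in(1) by fastforce
  have "inj_on ((`) f) ?E"
    using inj_on_image_eq_iff[OF strict_mono_on_imp_inj_on[OF f]] sub by (auto intro!: inj_onI)
  moreover have "(`) f ` ?E \<subseteq> E" using edge A by (auto simp: f_def)
  ultimately show ?thesis
    using f fV unfolding contains_def perm_graph_def prod.case
    by (intro exI[of _ f] exI[of _ "(`) f"]) auto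
qed

text \<open>Vertices are replaced by their ranks through \<open>w\<close>. Each edge then comes from
  an entry of the strictly upper triangular adjacency matrix, whose size is the number of
  vertices.\<close>

lemma card_edges_le_of_avoids:
  fixes V :: "nat set"
  assumes "finite V" "ograph (V, E)" "avoids (V, E) (perm_graph k \<pi>)" "\<pi> permutes {1..k}" "k > 0"
  shows "card E \<le> k * 2 ^ (4 * k + 7) * card V"
proof -
  define n where "n = card V"
  define w where "w = nth (sorted_list_of_set V)"
  have w: "strict_mono_on {..<n} w" "w ` {..<n} = V"
  proof -
    show "strict_mono_on {..<n} w"
      using assms(1) by (auto intro!: strict_mono_onI sorted_wrt_nth_less[of "(<)"] simp: w_def n_def)
    show "w ` {..<n} = V"
      using nth_image[of n "sorted_list_of_set V"] assms(1) by (simp add: w_def n_def lessThan_atLeast0)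
  qed
  define A where "A = {(i, j). i < j \<and> j < n \<and> {w i, w j} \<in> E}"
  have A: "A \<subseteq> {..<n} \<times> {..<n}" by (auto simp: A_def)
  have "E \<subseteq> (\<lambda>(i, j). {w i, w j}) ` A"
  proof
    fix e assume e: "e \<in> E"
    then obtain x y where xy: "e = {x, y}" "x \<noteq> y" "x \<in> V" "y \<in> V"
      using assms(2) by (fastforce simp: ograph_def card_2_iff)
    then obtain i j where ij: "x = w i" "y = w j" "i < n" "j < n" using w(2) by auto
    then have "i < j \<or> j < i" using xy by (metis linorder_neqE_nat)
    then have "(i, j) \<in> A \<or> (j, i) \<in> A" using ij e xy by (auto simp: A_def insert_commute)
    then show "e \<in> (\<lambda>(i, j). {w i, w j}) ` A" using ij xy by (force simp: insert_commute)
  qed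
  then have "card E \<le> card A"
    using finite_subset[OF A] by (intro surj_card_le) auto
  also have "\<not> grid_minor (Suc k) (Suc k) A"
    using contains_perm_graph_of_grid_minor[OF w(1) _ A_def] w(2) assms(3,4) by blast
  then have "card A \<le> k * 2 ^ (4 * k + 7) * n"
    using card_le_of_not_grid_minor[OF A] assms(5) by blast
  finally show ?thesis by (simp add: n_def)
qed

theorem corollary2p4:
  fixes k n :: nat and Q :: "nat ograph"
  assumes "k > 0" and "n > 0" and "is_permutation_graph k Q"
  shows "real (gex Q n) \<le> 8 / 3 * (real k + 2) ^ 2 * 2 ^ (4 * (k + 1)) * real n"
proof -
  obtain \<pi> where \<pi>: "\<pi> permutes {1..k}" "Q = perm_graph k \<pi>"
    using assms(3) by (auto simp: is_permutation_graph_def)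
  have "snd Q \<noteq> {}" using \<open>k > 0\<close> by (auto simp: \<pi>(2) perm_graph_def)
  then obtain V :: "nat set" and E where "finite V" "card V = n" "ograph (V, E)" "avoids (V, E) Q"
    "card E = gex Q n"
    using gex_attained[of Q n] by blast
  then have "gex Q n \<le> k * 2 ^ (4 * k + 7) * n"
    using card_edges_le_of_avoids[of V E k \<pi>] \<pi> \<open>k > 0\<close> by simp
  then have "real (gex Q n) \<le> real (k * 2 ^ (4 * k + 7) * n)" by (rule of_nat_mono)
  \<comment> \<open>The exponent \<open>4 * k + 7\<close> is \<open>4 * (k + 1) + 3\<close>, so only
    \<open>3 * k \<le> (k + 2) ^ 2\<close> is left to check.\<close>
  also have "\<dots> = 8 * real k * 2 ^ (4 * (k + 1)) * real n" by (simp add: power_add)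
  also have "\<dots> \<le> 8 / 3 * (real k + 2) ^ 2 * 2 ^ (4 * (k + 1)) * real n"
  proof (intro mult_right_mono)
    have "(real k + 2) ^ 2 = (real k - 1) ^ 2 + 6 * real k + 3" by (simp add: power2_eq_square algebra_simps)
    then show "8 * real k \<le> 8 / 3 * (real k + 2) ^ 2" using zero_le_power2[of "real k - 1"] by simp
  qed auto
  finally show ?thesis .
qed

end
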